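(* Let $G$ be a finitely generated group, $A$ a finite alphabet and $X\subset A^G$ an effectively closed subshift. Then there exists a decidable set of pattern codings $\mathcal C$ such that $X=X_{\mathcal C}$.
   Context: Let $S\subset G$ be a finite generating set closed under inverses and containing $1_G$; words in $S^*$ represent elements of $G$. $A^G$ has the product topology and left shift action $(\sigma_g x)_h=x_{g^{-1}h}$; a subshift is a closed shift-invariant subset. Put $[a]_g=\{x\in A^G:x_g=a\}$. A pattern coding over $A$ is a finite set $c$ of pairs $(w,a)$ with $w\in S^*$, $a\in A$. For a set $\mathcal C$ of pattern codings, $X_{\mathcal C}=\bigcap_{g\in G,\,c\in\mathcal C}\big(A^G\setminus\bigcap_{(w,a)\in c}[a]_{gw}\big)$. $X\subset A^G$ is effectively closed if $X=X_{\mathcal C'}$ for some recursively enumerable set $\mathcal C'$ of pattern codings. *)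

theory Defs
  imports "HOL-Algebra.Generated_Groups" "HOL-Analysis.Function_Topology"
    "HOL-Library.Nat_Bijection" "HOL-Library.Countable_Set"
begin

section \<open>Partial recursive functions\<close>

text \<open>Kleene's \<open>\<mu>\<close>-recursive functions. In \<open>RRec f g\<close> the recursion variable is the first
  argument, and \<open>g\<close> receives the recursion variable, the previous value and the parameters,
  in this order. In \<open>RMin f\<close> the variable minimised over is the first argument of \<open>f\<close>.\<close>

datatype recf = RZero | RSucc | RProj nat | RComp recf "recf list" | RRec recf recf | RMin recf

inductive computes :: "recf \<Rightarrow> nat list \<Rightarrow> nat \<Rightarrow> bool" where
  zero: "computes RZero xs 0"
| succ: "computes RSucc [x] (Suc x)"
| proj: "i < length xs \<Longrightarrow> computes (RProj i) xs (xs ! i)"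
| comp: "list_all2 (\<lambda>g y. computes g xs y) gs ys \<Longrightarrow> computes f ys z \<Longrightarrow> computes (RComp f gs) xs z"
| rec_0: "computes f xs y \<Longrightarrow> computes (RRec f g) (0 # xs) y"
| rec_Suc: "computes (RRec f g) (n # xs) y \<Longrightarrow> computes g (n # y # xs) z
    \<Longrightarrow> computes (RRec f g) (Suc n # xs) z"
| min: "computes f (n # xs) 0 \<Longrightarrow> (\<And>m. m < n \<Longrightarrow> \<exists>k. computes f (m # xs) (Suc k))
    \<Longrightarrow> computes (RMin f) xs n"

inductive_cases computes_zeroE: "computes RZero xs y"
inductive_cases computes_succE: "computes RSucc xs y"
inductive_cases computes_projE: "computes (RProj i) xs y"
inductive_cases computes_compE: "computes (RComp f gs) xs y"
inductive_cases computes_rec_0E: "computes (RRec f g) (0 # xs) y"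
inductive_cases computes_rec_SucE: "computes (RRec f g) (Suc n # xs) y"
inductive_cases computes_minE: "computes (RMin f) xs y"

lemma computes_deterministic:
  "computes r xs y \<Longrightarrow> computes r xs z \<Longrightarrow> y = z"
proof (induction arbitrary: z rule: computes.induct)
  case (zero xs)
  then show ?case by (blast elim: computes_zeroE)
next
  case (succ x)
  then show ?case by (rule computes_succE) simp
next
  case (proj i xs)
  from proj(2) show ?case by (rule computes_projE) simp
next
  case (comp xs gs ys f u)
  from comp.prems obtain ys' where ys': "list_all2 (\<lambda>g y. computes g xs y) gs ys'"
    and z: "computes f ys' z"
    by (rule computes_compE)
  have "ys = ys'"
    using comp.IH(1) ys' by (simp add: list_all2_conv_all_nth list_eq_iff_nth_eq)
  then show ?case using comp.IH(2) z by blast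
next
  case (rec_0 f xs y g)
  then show ?case by (blast elim: computes_rec_0E)
next
  case (rec_Suc f g n xs y u)
  from rec_Suc.prems obtain y' where "computes (RRec f g) (n # xs) y'" "computes g (n # y' # xs) z"
    by (rule computes_rec_SucE)
  then show ?case using rec_Suc.IH by blast
next
  case (min f n xs)
  from min.prems have z: "computes f (z # xs) 0"
    and lt: "\<And>m. m < z \<Longrightarrow> \<exists>k. computes f (m # xs) (Suc k)"
    by (rule computes_minE, blast)+
  show ?case
  proof (rule linorder_cases[of n z])
    assume "n < z" then show ?thesis using lt min.IH(1) by blast
  next
    assume "z < n" then show ?thesis using min.IH(2) z by blast
  qed
qed

definition decidable_set :: "nat set \<Rightarrow> bool" where
  "decidable_set N \<longleftrightarrow> (\<exists>r. \<forall>n. computes r [n] (if n \<in> N then 1 else 0))"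

text \<open>Recursively enumerable sets are taken to be the domains of partial recursive functions.\<close>

definition recursively_enumerable_set :: "nat set \<Rightarrow> bool" where
  "recursively_enumerable_set N \<longleftrightarrow> (\<exists>r. \<forall>n. n \<in> N \<longleftrightarrow> (\<exists>y. computes r [n] y))"


section \<open>Subshifts on groups\<close>

text \<open>Configurations are extensional functions (\<open>undefined\<close> outside the carrier), so that the full
  shift is the underlying set of the product topology below.\<close>

definition full_shift :: "('g, 'm) monoid_scheme \<Rightarrow> 'a set \<Rightarrow> ('g \<Rightarrow> 'a) set" where
  "full_shift G A = carrier G \<rightarrow>\<^sub>E A"

definition full_shift_topology :: "('g, 'm) monoid_scheme \<Rightarrow> 'a set \<Rightarrow> ('g \<Rightarrow> 'a) topology" where
  "full_shift_topology G A = product_topology (\<lambda>_. discrete_topology A) (carrier G)"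

lemma topspace_full_shift_topology: "topspace (full_shift_topology G A) = full_shift G A"
  by (simp add: full_shift_topology_def full_shift_def)

definition shift :: "('g, 'm) monoid_scheme \<Rightarrow> 'g \<Rightarrow> ('g \<Rightarrow> 'a) \<Rightarrow> 'g \<Rightarrow> 'a" where
  "shift G g x = (\<lambda>h\<in>carrier G. x (inv\<^bsub>G\<^esub> g \<otimes>\<^bsub>G\<^esub> h))"

definition subshift :: "('g, 'm) monoid_scheme \<Rightarrow> 'a set \<Rightarrow> ('g \<Rightarrow> 'a) set \<Rightarrow> bool" where
  "subshift G A X \<longleftrightarrow>
    closedin (full_shift_topology G A) X \<and> (\<forall>g\<in>carrier G. shift G g ` X \<subseteq> X)"

definition cylinder :: "('g, 'm) monoid_scheme \<Rightarrow> 'a set \<Rightarrow> 'a \<Rightarrow> 'g \<Rightarrow> ('g \<Rightarrow> 'a) set" where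
  "cylinder G A a g = {x \<in> full_shift G A. x g = a}"


section \<open>Pattern codings\<close>

definition symmetric_generating_set :: "('g, 'm) monoid_scheme \<Rightarrow> 'g set \<Rightarrow> bool" where
  "symmetric_generating_set G S \<longleftrightarrow>
    finite S \<and> S \<subseteq> carrier G \<and> generate G S = carrier G \<and>
    (\<forall>s\<in>S. inv\<^bsub>G\<^esub> s \<in> S) \<and> \<one>\<^bsub>G\<^esub> \<in> S"

definition word_value :: "('g, 'm) monoid_scheme \<Rightarrow> 'g list \<Rightarrow> 'g" where
  "word_value G w = foldr (\<lambda>s h. s \<otimes>\<^bsub>G\<^esub> h) w \<one>\<^bsub>G\<^esub>"

definition pattern_codings :: "'g set \<Rightarrow> 'a set \<Rightarrow> ('g list \<times> 'a) set set" where
  "pattern_codings S A = {c. finite c \<and> c \<subseteq> lists S \<times> A}"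

text \<open>Intersections are relative to the full shift: the empty one is the full shift.\<close>

definition avoiding ::
    "('g, 'm) monoid_scheme \<Rightarrow> 'a set \<Rightarrow> ('g list \<times> 'a) set set \<Rightarrow> ('g \<Rightarrow> 'a) set" where
  "avoiding G A C = full_shift G A \<inter>
    (\<Inter>g\<in>carrier G. \<Inter>c\<in>C. full_shift G A -
      (full_shift G A \<inter> (\<Inter>(w, a)\<in>c. cylinder G A a (g \<otimes>\<^bsub>G\<^esub> word_value G w))))"


section \<open>Computability of sets of pattern codings\<close>

text \<open>\<open>to_nat_on S\<close> is a bijection from the finite set \<open>S\<close> to an initial segment of the naturals.
  Which one does not matter: any two differ by a permutation of finitely many letters.\<close>

definition pattern_code :: "'g set \<Rightarrow> 'a set \<Rightarrow> ('g list \<times> 'a) set \<Rightarrow> nat" where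
  "pattern_code S A c = set_encode
    ((\<lambda>(w, a). prod_encode (list_encode (map (to_nat_on S) w), to_nat_on A a)) ` c)"

lemma inj_on_pattern_code:
  assumes "finite S" "finite A"
  shows "inj_on (pattern_code S A) (pattern_codings S A)"
proof -
  let ?e = "\<lambda>(w, a). prod_encode (list_encode (map (to_nat_on S) w), to_nat_on A a)"
  have S: "inj_on (to_nat_on S) S" and A: "inj_on (to_nat_on A) A"
    using assms[THEN countable_finite] by (simp_all only: inj_on_to_nat_on)
  have e: "inj_on ?e (lists S \<times> A)"
  proof (rule inj_onI)
    fix p q assume "p \<in> lists S \<times> A" "q \<in> lists S \<times> A" "?e p = ?e q"
    moreover obtain v a w b where pq: "p = (v, a)" "q = (w, b)"
      by (cases p, cases q)
    ultimately have v: "v \<in> lists S" and w: "w \<in> lists S" and ab: "a \<in> A" "b \<in> A"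
      and "prod_encode (list_encode (map (to_nat_on S) v), to_nat_on A a) =
        prod_encode (list_encode (map (to_nat_on S) w), to_nat_on A b)"
      by (simp_all only: mem_Sigma_iff prod.case)
    then have vw: "map (to_nat_on S) v = map (to_nat_on S) w" and "to_nat_on A a = to_nat_on A b"
      by (simp_all add: list_encode_eq)
    moreover have "inj_on (to_nat_on S) (set v \<union> set w)"
      using v w by (intro inj_on_subset[OF S]) (simp add: in_lists_conv_set subset_iff)
    ultimately show "p = q"
      using inj_onD[OF A _ ab] by (simp add: pq inj_on_map_eq_map)
  qed
  show ?thesis
  proof (rule inj_onI)
    fix c d assume c: "c \<in> pattern_codings S A" and d: "d \<in> pattern_codings S A"
      and "pattern_code S A c = pattern_code S A d"
    moreover have "finite c" "finite d"
      using c d by (simp_all add: pattern_codings_def)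
    ultimately have "?e ` c = ?e ` d"
      using set_encode_eq[of "?e ` c" "?e ` d"] by (simp only: pattern_code_def finite_imageI)
    moreover have "c \<subseteq> lists S \<times> A" "d \<subseteq> lists S \<times> A"
      using c d by (simp_all only: pattern_codings_def mem_Collect_eq)
    ultimately show "c = d"
      using inj_on_image_eq_iff[OF e] by blast
  qed
qed

definition decidable_codings :: "'g set \<Rightarrow> 'a set \<Rightarrow> ('g list \<times> 'a) set set \<Rightarrow> bool" where
  "decidable_codings S A C \<longleftrightarrow>
    C \<subseteq> pattern_codings S A \<and> decidable_set (pattern_code S A ` C)"

definition recursively_enumerable_codings ::
    "'g set \<Rightarrow> 'a set \<Rightarrow> ('g list \<times> 'a) set set \<Rightarrow> bool" where
  "recursively_enumerable_codings S A C \<longleftrightarrow>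
    C \<subseteq> pattern_codings S A \<and> recursively_enumerable_set (pattern_code S A ` C)"

definition effectively_closed ::
    "('g, 'm) monoid_scheme \<Rightarrow> 'g set \<Rightarrow> 'a set \<Rightarrow> ('g \<Rightarrow> 'a) set \<Rightarrow> bool" where
  "effectively_closed G S A X \<longleftrightarrow>
    (\<exists>C. recursively_enumerable_codings S A C \<and> X = avoiding G A C)"

end

theory Submission
  imports Defs
begin

text \<open>Adding to a pattern coding \<open>c\<close> a second word for one of its elements does not change the
  pattern that \<open>c\<close> describes: as \<open>1\<^sub>G \<in> S\<close>, a pair \<open>(w, a) \<in> c\<close> may be
  accompanied by \<open>(1\<^sub>G\<dots>1\<^sub>G w, a)\<close>. This makes the code of \<open>c\<close> as large as desired, and a large
  code can serve as a time bound. Given an enumerable \<open>\<C>\<close>, take all paddings \<open>c'\<close> of members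
  \<open>c\<close> of \<open>\<C>\<close> such that the membership of \<open>c\<close> in \<open>\<C>\<close> is confirmed by a computation with
  resources bounded by the code of \<open>c'\<close>. Every \<open>c \<in> \<C>\<close> has such a padding, so the same
  configurations are avoided; and the new set is decidable, since both the search for \<open>c\<close> and the
  simulated computation are bounded in terms of \<open>c'\<close>. Only \<open>c = {}\<close> cannot be padded, but
  if \<open>{} \<in> \<C>\<close>, then \<open>X\<close> is empty and \<open>{{}}\<close> is a decidable set that defines it.

  The time bound is provided by an evaluator \<open>fuel_eval\<close> for each recursive function, defined by
  recursion on its description. For a fixed description it is a total computable function of the
  fuel and the arguments (\<open>computable_fuel_eval\<close>), built up along the description itself. Its results
  are correct (\<open>computes_if_fuel_eval\<close>), and every convergent computation succeeds with all
  sufficiently large amounts of fuel (\<open>eventually_fuel_eval\<close>); in this form finitely many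
  computations can be combined by the filter of eventual truth. The existence of a padding that
  is long enough is \<open>exists_padding\<close>.\<close>

section \<open>Total computable functions and decidable relations\<close>

definition computable :: "nat \<Rightarrow> (nat list \<Rightarrow> nat) \<Rightarrow> bool" where
  "computable k f \<longleftrightarrow> (\<exists>r. \<forall>xs. length xs = k \<longrightarrow> computes r xs (f xs))"

definition computable_list :: "nat \<Rightarrow> nat \<Rightarrow> (nat list \<Rightarrow> nat list) \<Rightarrow> bool" where
  "computable_list k m \<sigma> \<longleftrightarrow>
    (\<exists>gs. length gs = m \<and> (\<forall>xs. length xs = k \<longrightarrow> list_all2 (\<lambda>g. computes g xs) gs (\<sigma> xs)))"

definition decidable_rel :: "nat \<Rightarrow> (nat list \<Rightarrow> bool) \<Rightarrow> bool" where
  "decidable_rel k P \<longleftrightarrow> computable k (\<lambda>xs. of_bool (P xs))"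

lemma computable_list_length:
  "computable_list k m \<sigma> \<Longrightarrow> length xs = k \<Longrightarrow> length (\<sigma> xs) = m"
  unfolding computable_list_def by (metis list_all2_lengthD)

lemma computable_cong:
  assumes "computable k f" "\<And>xs. length xs = k \<Longrightarrow> f xs = g xs"
  shows "computable k g"
  using assms unfolding computable_def by metis

lemma computable_comp:
  assumes "computable m f" "computable_list k m \<sigma>"
  shows "computable k (\<lambda>xs. f (\<sigma> xs))"
proof -
  obtain r where r: "\<And>xs. length xs = m \<Longrightarrow> computes r xs (f xs)"
    using assms(1) unfolding computable_def by blast
  obtain gs where gs: "\<And>xs. length xs = k \<Longrightarrow> list_all2 (\<lambda>g. computes g xs) gs (\<sigma> xs)"
    using assms(2) unfolding computable_list_def by blast
  have "computes (RComp r gs) xs (f (\<sigma> xs))" if "length xs = k" for xs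
    using computes.comp[OF gs[OF that] r] computable_list_length[OF assms(2) that] by simp
  then show ?thesis unfolding computable_def by blast
qed

lemma computable_list_Nil: "computable_list k 0 (\<lambda>xs. [])"
  by (simp add: computable_list_def)

lemma computable_list_Cons:
  assumes "computable k f" "computable_list k m \<sigma>"
  shows "computable_list k (Suc m) (\<lambda>xs. f xs # \<sigma> xs)"
proof -
  obtain r where r: "\<And>xs. length xs = k \<Longrightarrow> computes r xs (f xs)"
    using assms(1) unfolding computable_def by blast
  obtain gs where gs: "length gs = m"
      "\<And>xs. length xs = k \<Longrightarrow> list_all2 (\<lambda>g. computes g xs) gs (\<sigma> xs)"
    using assms(2) unfolding computable_list_def by blast
  show ?thesis
    unfolding computable_list_def by (rule exI[of _ "r # gs"]) (simp add: r gs)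
qed

lemma computable_list_id: "computable_list k k (\<lambda>xs. xs)"
  unfolding computable_list_def
  by (rule exI[of _ "map RProj [0..<k]"]) (auto simp: list_all2_conv_all_nth intro: computes.proj)

lemma computable_list_tl:
  assumes "computable_list k m \<sigma>"
  shows "computable_list k (m - 1) (\<lambda>xs. tl (\<sigma> xs))"
proof -
  obtain gs where gs: "length gs = m"
      "\<And>xs. length xs = k \<Longrightarrow> list_all2 (\<lambda>g. computes g xs) gs (\<sigma> xs)"
    using assms unfolding computable_list_def by blast
  have "list_all2 (\<lambda>g. computes g xs) (tl gs) (tl (\<sigma> xs))" if "length xs = k" for xs
    using gs(2)[OF that] by (auto simp: list_all2_conv_all_nth nth_tl)
  then show ?thesis
    unfolding computable_list_def by (intro exI[of _ "tl gs"]) (simp add: gs(1))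
qed

lemma computable_nth:
  assumes "computable_list k m \<sigma>" "i < m"
  shows "computable k (\<lambda>xs. \<sigma> xs ! i)"
  using assms unfolding computable_list_def computable_def list_all2_conv_all_nth by metis

lemma computable_hd:
  assumes "computable_list k m \<sigma>" "0 < m"
  shows "computable k (\<lambda>xs. hd (\<sigma> xs))"
  by (rule computable_cong[OF computable_nth[OF assms]])
    (metis assms computable_list_length hd_conv_nth length_greater_0_conv)

lemma computable_list_map:
  assumes "\<And>g. g \<in> set gs \<Longrightarrow> computable k (f g)"
  shows "computable_list k (length gs) (\<lambda>xs. map (\<lambda>g. f g xs) gs)"
  using assms by (induction gs) (auto intro: computable_list_Nil computable_list_Cons)

lemma computable_Suc:
  assumes "computable k f"
  shows "computable k (\<lambda>xs. Suc (f xs))"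
proof -
  have "computable 1 (\<lambda>xs. Suc (hd xs))"
    unfolding computable_def
    by (rule exI[of _ RSucc]) (auto simp: length_Suc_conv intro: computes.succ)
  from computable_comp[OF this, of k "\<lambda>xs. [f xs]"] show ?thesis
    using computable_list_Cons[OF assms computable_list_Nil] by simp
qed

lemma computable_const: "computable k (\<lambda>xs. c)"
proof (induction c)
  case 0
  show ?case unfolding computable_def by (rule exI[of _ RZero]) (simp add: computes.zero)
qed (rule computable_Suc)

text \<open>The environment of the step function is \<open>i # y # xs\<close>, with the recursion variable and the previous
  value before the parameters. Stated for an expression in \<open>xs\<close>, the rule can be used
  backwards on nested expressions.\<close>

lemma computable_rec:
  assumes z: "computable k z"
    and st: "computable (Suc (Suc k)) (\<lambda>ys. st (hd ys) (hd (tl ys)) (tl (tl ys)))"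
    and n: "computable k n"
  shows "computable k (\<lambda>xs. rec_nat (z xs) (\<lambda>i y. st i y xs) (n xs))"
proof -
  obtain rz where rz: "\<And>xs. length xs = k \<Longrightarrow> computes rz xs (z xs)"
    using z unfolding computable_def by blast
  obtain rs where rs:
      "\<And>ys. length ys = Suc (Suc k) \<Longrightarrow> computes rs ys (st (hd ys) (hd (tl ys)) (tl (tl ys)))"
    using st unfolding computable_def by blast
  have rec: "computes (RRec rz rs) (i # xs) (rec_nat (z xs) (\<lambda>i y. st i y xs) i)"
    if "length xs = k" for i xs
  proof (induction i)
    case 0
    show ?case using rz[OF that] by (simp add: computes.rec_0)
  next
    case (Suc i)
    from computes.rec_Suc[OF this] rs[of "i # _ # xs"] that show ?case by simp
  qed
  have "computable (Suc k) (\<lambda>ys. rec_nat (z (tl ys)) (\<lambda>i y. st i y (tl ys)) (hd ys))"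
    unfolding computable_def
    by (rule exI[of _ "RRec rz rs"]) (auto simp: length_Suc_conv rec)
  from computable_comp[OF this computable_list_Cons[OF n computable_list_id]]
  show ?thesis by simp
qed

lemma computable_weaken:
  assumes "computable k f"
  shows "computable (Suc (Suc k)) (\<lambda>ys. f (tl (tl ys)))"
  using computable_comp[OF assms] computable_list_tl[OF computable_list_tl[OF computable_list_id]]
  by (metis diff_Suc_1)

lemma computable_list_weaken:
  assumes "computable_list k m \<sigma>"
  shows "computable_list (Suc (Suc k)) m (\<lambda>ys. \<sigma> (tl (tl ys)))"
proof -
  have "computable_list (Suc (Suc k)) (length [0..<m])
      (\<lambda>ys. map (\<lambda>i. \<sigma> (tl (tl ys)) ! i) [0..<m])"
    by (rule computable_list_map computable_weaken computable_nth[OF assms] | simp)+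
  moreover have "map (\<lambda>i. \<sigma> (tl (tl ys)) ! i) [0..<m] = \<sigma> (tl (tl ys))"
    if "length ys = Suc (Suc k)" for ys
    using computable_list_length[OF assms, of "tl (tl ys)"] that
    by (metis diff_Suc_1 length_tl map_nth)
  ultimately show ?thesis by (simp add: computable_list_def)
qed

lemmas computable_list_intros =
  computable_list_Nil computable_list_Cons computable_list_id computable_list_tl

lemmas computable_base_intros =
  computable_list_intros computable_const computable_Suc computable_nth computable_hd

lemma computable_pred:
  assumes "computable k f"
  shows "computable k (\<lambda>xs. f xs - 1)"
proof -
  have "computable k (\<lambda>xs. rec_nat 0 (\<lambda>i y. i) (f xs))"
    by (rule computable_rec computable_base_intros assms | simp)+
  moreover have "rec_nat 0 (\<lambda>i y. i) n = n - 1" for n :: nat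
    by (cases n) simp_all
  ultimately show ?thesis by simp
qed

lemma computable_add:
  assumes "computable k f" "computable k g"
  shows "computable k (\<lambda>xs. f xs + g xs)"
proof -
  have "computable k (\<lambda>xs. rec_nat (f xs) (\<lambda>i y. Suc y) (g xs))"
    by (rule computable_rec computable_base_intros assms | simp)+
  moreover have "rec_nat m (\<lambda>i y. Suc y) n = m + n" for m n :: nat
    by (induction n) simp_all
  ultimately show ?thesis by simp
qed

lemma computable_diff:
  assumes "computable k f" "computable k g"
  shows "computable k (\<lambda>xs. f xs - g xs)"
proof -
  have "computable k (\<lambda>xs. rec_nat (f xs) (\<lambda>i y. y - 1) (g xs))"
    by (rule computable_rec computable_pred computable_base_intros assms | simp)+
  moreover have "rec_nat m (\<lambda>i y. y - 1) n = m - n" for m n :: nat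
    by (induction n) simp_all
  ultimately show ?thesis by simp
qed

lemma computable_mult:
  assumes "computable k f" "computable k g"
  shows "computable k (\<lambda>xs. f xs * g xs)"
proof -
  have "computable k (\<lambda>xs. rec_nat 0 (\<lambda>i y. y + f xs) (g xs))"
    by (rule computable_rec computable_add computable_base_intros assms
        computable_weaken[OF assms(1)] | simp)+
  moreover have "rec_nat 0 (\<lambda>i y. y + m) n = m * n" for m n :: nat
    by (induction n) simp_all
  ultimately show ?thesis by simp
qed

lemma computable_power2:
  assumes "computable k f"
  shows "computable k (\<lambda>xs. 2 ^ f xs)"
proof -
  have "computable k (\<lambda>xs. rec_nat 1 (\<lambda>i y. y + y) (f xs))"
    by (rule computable_rec computable_add computable_base_intros assms | simp)+
  moreover have "rec_nat 1 (\<lambda>i y. y + y) n = (2 :: nat) ^ n" for n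
    by (induction n) simp_all
  ultimately show ?thesis by simp
qed

lemma computable_prod_encode:
  assumes "computable k f" "computable k g"
  shows "computable k (\<lambda>xs. prod_encode (f xs, g xs))"
proof -
  have "computable k (\<lambda>xs. rec_nat 0 (\<lambda>i y. y + Suc i) (f xs + g xs) + f xs)"
    by (rule computable_rec computable_add computable_base_intros assms | simp)+
  moreover have "rec_nat 0 (\<lambda>i y. y + Suc i) n = triangle n" for n :: nat
    by (induction n) simp_all
  ultimately show ?thesis by (simp add: prod_encode_def)
qed

lemma decidable_not:
  assumes "decidable_rel k P"
  shows "decidable_rel k (\<lambda>xs. \<not> P xs)"
proof -
  have "computable k (\<lambda>xs. 1 - of_bool (P xs))"
    using assms unfolding decidable_rel_def by (intro computable_diff computable_const)
  then show ?thesis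
    unfolding decidable_rel_def by (rule computable_cong) simp
qed

lemma decidable_conj:
  assumes "decidable_rel k P" "decidable_rel k Q"
  shows "decidable_rel k (\<lambda>xs. P xs \<and> Q xs)"
proof -
  have "computable k (\<lambda>xs. of_bool (P xs) * of_bool (Q xs))"
    using assms unfolding decidable_rel_def by (intro computable_mult)
  then show ?thesis
    unfolding decidable_rel_def by (rule computable_cong) simp
qed

lemma decidable_less:
  assumes "computable k f" "computable k g"
  shows "decidable_rel k (\<lambda>xs. f xs < g xs)"
proof -
  \<comment> \<open>Truncated subtraction: the value is 1 if \<open>f xs < g xs\<close>, and 0 otherwise.\<close>
  have "computable k (\<lambda>xs. 1 - (Suc (f xs) - g xs))"
    by (rule computable_diff computable_base_intros assms | simp)+
  then show ?thesis
    unfolding decidable_rel_def by (rule computable_cong) auto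
qed

lemma decidable_eq:
  assumes "computable k f" "computable k g"
  shows "decidable_rel k (\<lambda>xs. f xs = g xs)"
proof -
  have "decidable_rel k (\<lambda>xs. \<not> f xs < g xs \<and> \<not> g xs < f xs)"
    by (rule decidable_conj decidable_not decidable_less assms | simp)+
  moreover have "(\<lambda>xs. \<not> f xs < g xs \<and> \<not> g xs < f xs) = (\<lambda>xs. f xs = g xs)"
    by auto
  ultimately show ?thesis by simp
qed

lemma computable_if:
  assumes "decidable_rel k P" "computable k f" "computable k g"
  shows "computable k (\<lambda>xs. if P xs then f xs else g xs)"
proof -
  have "computable k (\<lambda>xs. of_bool (P xs) * f xs + (1 - of_bool (P xs)) * g xs)"
    using assms unfolding decidable_rel_def
    by (intro computable_add computable_mult computable_diff computable_const)
  then show ?thesis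
    by (rule computable_cong) simp
qed

lemma decidable_list_all:
  assumes "\<And>g. g \<in> set gs \<Longrightarrow> decidable_rel k (P g)"
  shows "decidable_rel k (\<lambda>xs. \<forall>g\<in>set gs. P g xs)"
  using assms
proof (induction gs)
  case Nil
  then show ?case by (simp add: decidable_rel_def computable_const)
next
  case (Cons g gs)
  then show ?case using decidable_conj[of k "P g" "\<lambda>xs. \<forall>g\<in>set gs. P g xs"] by simp
qed

text \<open>Bounded search: the successor of the least \<open>i < b\<close> with \<open>P i\<close>, or 0 if there is none.\<close>

definition first_below :: "(nat \<Rightarrow> bool) \<Rightarrow> nat \<Rightarrow> nat" where
  "first_below P b = rec_nat 0 (\<lambda>i y. if y = 0 then (if P i then Suc i else 0) else y) b"

lemma first_below_eq_0_iff: "first_below P b = 0 \<longleftrightarrow> (\<forall>i<b. \<not> P i)"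
  by (induction b) (auto simp: first_below_def less_Suc_eq)

lemma first_below_eq_Suc_iff: "first_below P b = Suc n \<longleftrightarrow> n < b \<and> P n \<and> (\<forall>i<n. \<not> P i)"
proof (induction b)
  case 0
  show ?case by (simp add: first_below_def)
next
  case (Suc b)
  have "first_below P (Suc b) =
      (if first_below P b = 0 then (if P b then Suc b else 0) else first_below P b)"
    by (simp add: first_below_def)
  with Suc first_below_eq_0_iff[of P b] show ?case
    by (auto simp: less_Suc_eq)
qed

text \<open>As in primitive recursion, the environment grows by two entries: the second one, the
  state of the search, is skipped by the predicate.\<close>

lemma computable_first_below:
  assumes "computable k b" "decidable_rel (Suc (Suc k)) (\<lambda>ys. P (hd ys) (tl (tl ys)))"
  shows "computable k (\<lambda>xs. first_below (\<lambda>i. P i xs) (b xs))"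
  unfolding first_below_def
  by (rule computable_rec computable_if decidable_eq computable_base_intros assms | simp)+

lemma decidable_bex:
  assumes "computable k b" "decidable_rel (Suc (Suc k)) (\<lambda>ys. P (hd ys) (tl (tl ys)))"
  shows "decidable_rel k (\<lambda>xs. \<exists>i<b xs. P i xs)"
proof -
  have "decidable_rel k (\<lambda>xs. \<not> first_below (\<lambda>i. P i xs) (b xs) = 0)"
    by (rule decidable_not decidable_eq computable_const computable_first_below assms | simp)+
  then show ?thesis by (simp add: first_below_eq_0_iff)
qed

lemma decidable_ball:
  assumes "computable k b" "decidable_rel (Suc (Suc k)) (\<lambda>ys. P (hd ys) (tl (tl ys)))"
  shows "decidable_rel k (\<lambda>xs. \<forall>i<b xs. P i xs)"
proof -
  have "decidable_rel k (\<lambda>xs. first_below (\<lambda>i. \<not> P i xs) (b xs) = 0)"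
    by (rule decidable_eq decidable_not computable_const computable_first_below assms | simp)+
  then show ?thesis by (simp add: first_below_eq_0_iff)
qed

lemmas computable_intros =
  computable_base_intros computable_add computable_diff computable_mult computable_power2
  computable_prod_encode computable_if computable_first_below
  decidable_not decidable_conj decidable_less decidable_eq decidable_bex decidable_ball

lemma odd_div_iff:
  fixes m d :: nat
  assumes "0 < d"
  shows "odd (m div d) \<longleftrightarrow> (\<exists>q<Suc m. \<exists>r<d. m = (q + q + 1) * d + r)"
proof
  assume "odd (m div d)"
  then obtain q where q: "m div d = q + q + 1" by (metis mult_2 oddE)
  then have "m = (q + q + 1) * d + m mod d" by (metis div_mult_mod_eq)
  moreover have "q < Suc m" using q div_le_dividend[of m d] by linarith
  ultimately show "\<exists>q<Suc m. \<exists>r<d. m = (q + q + 1) * d + r"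
    using assms mod_less_divisor by blast
next
  assume "\<exists>q<Suc m. \<exists>r<d. m = (q + q + 1) * d + r"
  then obtain q r where "r < d" and m: "m = (q + q + 1) * d + r" by blast
  have "m div d = q + q + 1 + r div d"
    unfolding m using assms by (intro div_mult_self3) simp
  with \<open>r < d\<close> show "odd (m div d)" by simp
qed

lemma decidable_mem_set_decode:
  assumes "computable k f" "computable k g"
  shows "decidable_rel k (\<lambda>xs. f xs \<in> set_decode (g xs))"
proof -
  have eq: "p \<in> set_decode m \<longleftrightarrow> (\<exists>q<Suc m. \<exists>r<2 ^ p. m = (q + q + 1) * 2 ^ p + r)" for p m
    unfolding set_decode_def using odd_div_iff[of "2 ^ p" m] by simp
  note weak = assms[THEN computable_weaken]
  show ?thesis
    unfolding eq by (rule computable_intros assms weak weak[THEN computable_weaken] | simp)+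
qed


section \<open>Evaluation with bounded resources\<close>

text \<open>The value \<open>Suc y\<close> means that the result is \<open>y\<close>, and 0 that no result is reached. Fuel limits only the
  unbounded searches: composition and primitive recursion terminate without it.\<close>

fun fuel_eval :: "recf \<Rightarrow> nat \<Rightarrow> nat list \<Rightarrow> nat" where
  "fuel_eval RZero s xs = 1"
| "fuel_eval RSucc s xs = (if length xs = 1 then Suc (Suc (hd xs)) else 0)"
| "fuel_eval (RProj i) s xs = (if i < length xs then Suc (xs ! i) else 0)"
| "fuel_eval (RComp f gs) s xs =
    (if \<forall>g\<in>set gs. fuel_eval g s xs \<noteq> 0
     then fuel_eval f s (map (\<lambda>g. fuel_eval g s xs - 1) gs) else 0)"
| "fuel_eval (RRec f g) s xs =
    (if length xs = 0 then 0
     else rec_nat (fuel_eval f s (tl xs))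
       (\<lambda>i y. if y = 0 then 0 else fuel_eval g s (i # (y - 1) # tl xs)) (hd xs))"
| "fuel_eval (RMin f) s xs =
    first_below (\<lambda>n. fuel_eval f s (n # xs) = 1 \<and> (\<forall>m<n. 1 < fuel_eval f s (m # xs))) s"

text \<open>For primitive recursion, the defining equations of the scheme are more convenient than \<open>rec_nat\<close>.\<close>

declare fuel_eval.simps(5) [simp del]

lemma fuel_eval_RRec_0 [simp]: "fuel_eval (RRec f g) s (0 # zs) = fuel_eval f s zs"
  by (simp add: fuel_eval.simps(5))

lemma fuel_eval_RRec_Suc [simp]:
  "fuel_eval (RRec f g) s (Suc n # zs) = (if fuel_eval (RRec f g) s (n # zs) = 0 then 0
    else fuel_eval g s (n # (fuel_eval (RRec f g) s (n # zs) - 1) # zs))"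
  unfolding fuel_eval.simps(5) list.sel by simp

lemma computes_if_fuel_eval: "fuel_eval r s xs = Suc y \<Longrightarrow> computes r xs y"
proof (induction r arbitrary: xs y)
  case RZero
  then show ?case by (simp add: computes.zero)
next
  case RSucc
  then show ?case by (auto simp: length_Suc_conv intro: computes.succ split: if_splits)
next
  case (RProj i)
  then show ?case by (auto intro: computes.proj split: if_splits)
next
  case (RComp f gs)
  let ?ys = "map (\<lambda>g. fuel_eval g s xs - 1) gs"
  have nz: "\<forall>g\<in>set gs. fuel_eval g s xs \<noteq> 0" and y: "fuel_eval f s ?ys = Suc y"
    using RComp.prems by (auto split: if_splits)
  have "list_all2 (\<lambda>g y. computes g xs y) gs ?ys"
    using RComp.IH(2) nz by (auto simp: list_all2_conv_all_nth)
  then show ?case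
    using computes.comp RComp.IH(1)[OF y] by blast
next
  case (RRec f g)
  then obtain n zs where xs: "xs = n # zs" by (cases xs) (auto simp: fuel_eval.simps(5))
  have "fuel_eval (RRec f g) s (n # zs) = Suc y \<Longrightarrow> computes (RRec f g) (n # zs) y" for y
  proof (induction n arbitrary: y)
    case 0
    then show ?case using RRec.IH(1) by (auto intro: computes.rec_0)
  next
    case (Suc n)
    let ?v = "fuel_eval (RRec f g) s (n # zs)"
    have v: "?v \<noteq> 0" and y: "fuel_eval g s (n # (?v - 1) # zs) = Suc y"
      using Suc.prems by (auto split: if_splits)
    have "computes (RRec f g) (n # zs) (?v - 1)"
      using v by (intro Suc.IH) simp
    then show ?case using RRec.IH(2)[OF y] by (rule computes.rec_Suc)
  qed
  then show ?case using RRec.prems xs by blast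
next
  case (RMin f)
  then have y: "fuel_eval f s (y # xs) = Suc 0" and "\<forall>m<y. 1 < fuel_eval f s (m # xs)"
    by (auto simp: first_below_eq_Suc_iff)
  moreover have "\<exists>k. v = Suc (Suc k)" if "1 < v" for v :: nat
    using that by presburger
  ultimately have "\<And>m. m < y \<Longrightarrow> \<exists>k. fuel_eval f s (m # xs) = Suc (Suc k)"
    by blast
  then have "\<And>m. m < y \<Longrightarrow> \<exists>k. computes f (m # xs) (Suc k)"
    using RMin.IH by meson
  with RMin.IH[OF y] show ?case
    by (rule computes.min)
qed

text \<open>A convergent computation uses finitely many subcomputations (one for each component of a
  composition, one for each value that a search rejects); if each of them succeeds with all
  sufficiently large amounts of fuel, then so do all of them together.\<close>

lemma eventually_fuel_eval:
  "computes r xs y \<Longrightarrow> \<forall>\<^sub>F s in sequentially. fuel_eval r s xs = Suc y"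
proof (induction rule: computes.induct)
  case (comp xs gs ys f z)
  have "\<forall>i<length gs. \<forall>\<^sub>F s in sequentially. fuel_eval (gs ! i) s xs = Suc (ys ! i)"
    and len: "length gs = length ys"
    using comp.IH(1) by (auto simp: list_all2_conv_all_nth)
  then have "\<forall>\<^sub>F s in sequentially. \<forall>i\<in>{..<length gs}. fuel_eval (gs ! i) s xs = Suc (ys ! i)"
    by (intro eventually_ball_finite) auto
  then show ?case using comp.IH(2)
  proof eventually_elim
    case (elim s)
    then have "map (\<lambda>g. fuel_eval g s xs - 1) gs = ys"
      by (auto simp: len intro: nth_equalityI)
    moreover have "\<forall>g\<in>set gs. fuel_eval g s xs \<noteq> 0"
      using elim(1) by (auto simp: in_set_conv_nth)
    ultimately show ?case using elim(2) by simp
  qed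
next
  case (rec_Suc f g n xs y z)
  from rec_Suc.IH show ?case
    by eventually_elim simp
next
  case (min f n xs)
  have "\<forall>m\<in>{..<n}. \<forall>\<^sub>F s in sequentially. 1 < fuel_eval f s (m # xs)"
  proof
    fix m assume "m \<in> {..<n}"
    then obtain k where "\<forall>\<^sub>F s in sequentially. fuel_eval f s (m # xs) = Suc (Suc k)"
      using min.IH(2) by blast
    then show "\<forall>\<^sub>F s in sequentially. 1 < fuel_eval f s (m # xs)"
      by eventually_elim simp
  qed
  then have "\<forall>\<^sub>F s in sequentially. \<forall>m\<in>{..<n}. 1 < fuel_eval f s (m # xs)"
    by (intro eventually_ball_finite) auto
  then show ?case
    using min.IH(1) eventually_gt_at_top[of n]
  proof eventually_elim
    case (elim s)
    then have "\<forall>i<n. fuel_eval f s (i # xs) \<noteq> 1" by (metis lessThan_iff less_irrefl)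
    with elim show ?case by (simp add: first_below_eq_Suc_iff)
  qed
qed simp_all

text \<open>By recursion on the description: every clause of \<open>fuel_eval\<close> is built from total computable operations.
  The recursive calls change the environment; the claim is stable under this because it is
  stated for arbitrary computable fuel and arguments.\<close>

lemma computable_fuel_eval:
  assumes "computable k s" "computable_list k m \<sigma>"
  shows "computable k (\<lambda>xs. fuel_eval r (s xs) (\<sigma> xs))"
  using assms
proof (induction r arbitrary: k m s \<sigma>)
  case RZero
  show ?case by (simp add: computable_const)
next
  case RSucc
  show ?case
  proof (cases "m = 1")
    case True
    have "computable k (\<lambda>xs. Suc (Suc (hd (\<sigma> xs))))"
      by (rule computable_intros RSucc | simp add: True)+
    then show ?thesis
      by (rule computable_cong) (simp add: True computable_list_length[OF RSucc(2)])
  next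
    case False
    show ?thesis
      by (rule computable_cong[OF computable_const[of k 0]])
        (use False in \<open>simp add: computable_list_length[OF RSucc(2)]\<close>)
  qed
next
  case (RProj i)
  show ?case
  proof (cases "i < m")
    case True
    have "computable k (\<lambda>xs. Suc (\<sigma> xs ! i))"
      by (rule computable_intros RProj | simp add: True)+
    then show ?thesis
      by (rule computable_cong) (simp add: True computable_list_length[OF RProj(2)])
  next
    case False
    show ?thesis
      by (rule computable_cong[OF computable_const[of k 0]])
        (use False in \<open>simp add: computable_list_length[OF RProj(2)]\<close>)
  qed
next
  case (RComp f gs)
  have args: "computable_list k (length gs) (\<lambda>xs. map (\<lambda>g. fuel_eval g (s xs) (\<sigma> xs) - 1) gs)"
    by (rule computable_list_map computable_pred RComp.IH(2) RComp.prems | simp)+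
  show ?case
    unfolding fuel_eval.simps
    by (rule computable_if decidable_list_all decidable_not decidable_eq computable_const
        RComp.IH args RComp.prems | assumption)+
next
  case (RRec f g)
  show ?case
  proof (cases "m = 0")
    case True
    show ?thesis
      by (rule computable_cong[OF computable_const[of k 0]])
        (simp add: True fuel_eval.simps(5) computable_list_length[OF RRec.prems(2)])
  next
    case False
    have "computable k (\<lambda>xs. rec_nat (fuel_eval f (s xs) (tl (\<sigma> xs)))
        (\<lambda>i y. if y = 0 then 0 else fuel_eval g (s xs) (i # (y - 1) # tl (\<sigma> xs))) (hd (\<sigma> xs)))"
      by (rule computable_rec computable_if decidable_eq computable_pred computable_base_intros
          RRec.IH computable_weaken[OF RRec.prems(1)] computable_list_weaken[OF RRec.prems(2)]
          RRec.prems | use False in simp)+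
    then show ?thesis
      by (rule computable_cong)
        (simp add: False fuel_eval.simps(5) computable_list_length[OF RRec.prems(2)])
  qed
next
  case (RMin f)
  note weak = computable_weaken[OF RMin.prems(1)] computable_list_weaken[OF RMin.prems(2)]
  note weak2 = computable_weaken[OF weak(1)] computable_list_weaken[OF weak(2)]
  show ?case
    unfolding fuel_eval.simps
    by (rule computable_intros RMin.IH weak weak2 RMin.prems | simp)+
qed


section \<open>Padding pattern codings\<close>

definition pair_code :: "'g set \<Rightarrow> 'a set \<Rightarrow> 'g list \<times> 'a \<Rightarrow> nat" where
  "pair_code S A = (\<lambda>(w, a). prod_encode (list_encode (map (to_nat_on S) w), to_nat_on A a))"

text \<open>If \<open>e\<close> is the code of a letter, this is the effect on codes of words of prepending \<open>k\<close>
  copies of the letter.\<close>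

definition pad_code :: "nat \<Rightarrow> nat \<Rightarrow> nat \<Rightarrow> nat" where
  "pad_code e l k = rec_nat l (\<lambda>i y. Suc (prod_encode (e, y))) k"

lemma list_encode_replicate_append:
  "list_encode (replicate k e @ xs) = pad_code e (list_encode xs) k"
  by (induction k) (simp_all add: pad_code_def)

lemma add_le_pad_code: "l + k \<le> pad_code e l k"
proof (induction k)
  case (Suc k)
  have "pad_code e l k \<le> prod_encode (e, pad_code e l k)" by (rule le_prod_encode_2)
  with Suc show ?case by (simp add: pad_code_def)
qed (simp add: pad_code_def)

lemma pair_code_pad:
  "pair_code S A (replicate k s @ w, a) =
    prod_encode (pad_code (to_nat_on S s) (list_encode (map (to_nat_on S) w)) k, to_nat_on A a)"
  by (simp add: pair_code_def list_encode_replicate_append map_replicate)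

lemma pattern_code_eq: "pattern_code S A c = set_encode (pair_code S A ` c)"
  by (simp add: pattern_code_def pair_code_def)

lemma pattern_code_insert:
  assumes "finite c" "pair_code S A p \<notin> pair_code S A ` c"
  shows "pattern_code S A (insert p c) = pattern_code S A c + 2 ^ pair_code S A p"
  using assms by (simp add: pattern_code_eq)

lemma set_decode_pattern_code:
  "finite c \<Longrightarrow> set_decode (pattern_code S A c) = pair_code S A ` c"
  by (simp add: pattern_code_eq)

text \<open>Here \<open>m\<close> plays the role of the code of the original coding and \<open>n\<close> that of the code of its padding;
  \<open>T n m\<close> tells whether \<open>m\<close> is confirmed with resources \<open>n\<close>. The code of the new pair must not occur in
  \<open>m\<close>, so that inserting the pair adds a power of two. All parameters are bounded by \<open>n\<close>, because
  a component of a pair is at most the code of the pair, and padding increases the code of a word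
  by at least the number of letters added.\<close>

definition padded_codes :: "(nat \<Rightarrow> nat \<Rightarrow> bool) \<Rightarrow> nat \<Rightarrow> nat set" where
  "padded_codes T e = {n. \<exists>m<n. \<exists>l<n. \<exists>a<n. \<exists>k<n. T n m \<and> prod_encode (l, a) \<in> set_decode m \<and>
    prod_encode (pad_code e l k, a) \<notin> set_decode m \<and> n = m + 2 ^ prod_encode (pad_code e l k, a)}"

lemma decidable_set_if_decidable_rel:
  assumes "decidable_rel 1 (\<lambda>xs. hd xs \<in> N)"
  shows "decidable_set N"
proof -
  obtain r where r: "\<And>xs. length xs = 1 \<Longrightarrow> computes r xs (of_bool (hd xs \<in> N))"
    using assms unfolding decidable_rel_def computable_def by blast
  have "computes r [n] (if n \<in> N then 1 else 0)" for n
    using r[of "[n]"] by (simp add: of_bool_def)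
  then show ?thesis unfolding decidable_set_def by blast
qed

lemma decidable_padded_codes:
  "decidable_set (padded_codes (\<lambda>n m. fuel_eval r n [m] \<noteq> 0) e)"
  unfolding padded_codes_def pad_code_def mem_Collect_eq
  by (rule decidable_set_if_decidable_rel, unfold mem_Collect_eq)
    (rule computable_intros computable_fuel_eval decidable_mem_set_decode computable_rec | simp)+

definition padded_codings ::
    "(nat \<Rightarrow> nat \<Rightarrow> bool) \<Rightarrow> 'g \<Rightarrow> 'g set \<Rightarrow> 'a set \<Rightarrow> ('g list \<times> 'a) set set \<Rightarrow> ('g list \<times> 'a) set set"
  where
  "padded_codings T s S A C = {insert (replicate k s @ w, a) c |k w a c. c \<in> C \<and> (w, a) \<in> c \<and>
    pair_code S A (replicate k s @ w, a) \<notin> pair_code S A ` c \<and>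
    T (pattern_code S A (insert (replicate k s @ w, a) c)) (pattern_code S A c)}"

lemma padded_codings_subset:
  assumes "C \<subseteq> pattern_codings S A" "s \<in> S"
  shows "padded_codings T s S A C \<subseteq> pattern_codings S A"
proof
  fix d assume "d \<in> padded_codings T s S A C"
  then obtain k w a c where d: "d = insert (replicate k s @ w, a) c" and "c \<in> C" "(w, a) \<in> c"
    unfolding padded_codings_def by blast
  moreover from this have "finite c" "c \<subseteq> lists S \<times> A"
    using assms(1) by (auto simp: pattern_codings_def)
  ultimately have "replicate k s @ w \<in> lists S" "a \<in> A"
    using assms(2) by auto
  then show "d \<in> pattern_codings S A"
    using \<open>finite c\<close> \<open>c \<subseteq> lists S \<times> A\<close> by (simp add: d pattern_codings_def)
qed

text \<open>Soundness of \<open>T\<close> makes the search on codes faithful: a confirmed number is the code of some \<open>c \<in> C\<close>,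
  hence the elements of its binary expansion are codes of pairs over \<open>S\<close> and \<open>A\<close>, and so is the padded one.
  This is why the conditions in \<open>padded_codes\<close> suffice to make a number the code of a pattern coding.\<close>

lemma pattern_code_padded_codings:
  assumes C: "C \<subseteq> pattern_codings S A"
    and T: "\<And>n m. T n m \<Longrightarrow> m \<in> pattern_code S A ` C"
  shows "pattern_code S A ` padded_codings T s S A C = padded_codes T (to_nat_on S s)"
    (is "_ = padded_codes T ?e")
proof (intro equalityI subsetI)
  fix n assume "n \<in> pattern_code S A ` padded_codings T s S A C"
  then obtain k w a c where c: "c \<in> C" "(w, a) \<in> c"
    and new: "pair_code S A (replicate k s @ w, a) \<notin> pair_code S A ` c"
    and n: "n = pattern_code S A (insert (replicate k s @ w, a) c)"
    and Tn: "T n (pattern_code S A c)"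
    unfolding padded_codings_def by blast
  define l b where "l = list_encode (map (to_nat_on S) w)" and "b = to_nat_on A a"
  define p where "p = prod_encode (pad_code ?e l k, b)"
  have fin: "finite c" using C c(1) by (auto simp: pattern_codings_def)
  have p: "pair_code S A (replicate k s @ w, a) = p"
    by (simp add: pair_code_pad p_def l_def b_def)
  have n_eq: "n = pattern_code S A c + 2 ^ p"
    using pattern_code_insert[OF fin new] by (simp add: n p)
  have "p < 2 ^ p" by simp
  then have "p < n" "pattern_code S A c < n" using n_eq by linarith+
  moreover have "pad_code ?e l k \<le> p" "b \<le> p"
    by (simp_all add: p_def le_prod_encode_1 le_prod_encode_2)
  ultimately have bounds: "pattern_code S A c < n" "l < n" "b < n" "k < n"
    using add_le_pad_code[of l k ?e] by linarith+
  have "prod_encode (l, b) \<in> set_decode (pattern_code S A c)"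
    using imageI[OF c(2), of "pair_code S A"]
    by (simp add: set_decode_pattern_code[OF fin] pair_code_def l_def b_def)
  moreover have "p \<notin> set_decode (pattern_code S A c)"
    using new by (simp add: set_decode_pattern_code[OF fin] p)
  ultimately show "n \<in> padded_codes T ?e"
    using bounds Tn n_eq unfolding padded_codes_def p_def by blast
next
  fix n assume "n \<in> padded_codes T ?e"
  then obtain m l b k where Tn: "T n m" and old: "prod_encode (l, b) \<in> set_decode m"
    and new: "prod_encode (pad_code ?e l k, b) \<notin> set_decode m"
    and n: "n = m + 2 ^ prod_encode (pad_code ?e l k, b)"
    unfolding padded_codes_def by blast
  obtain c where c: "c \<in> C" and m: "m = pattern_code S A c" using T[OF Tn] by blast
  have fin: "finite c" using C c by (auto simp: pattern_codings_def)
  obtain w a where wa: "(w, a) \<in> c" and "prod_encode (l, b) = pair_code S A (w, a)"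
    using old by (auto simp: m set_decode_pattern_code[OF fin])
  then have "l = list_encode (map (to_nat_on S) w)" "b = to_nat_on A a"
    by (simp_all add: pair_code_def)
  then have p: "prod_encode (pad_code ?e l k, b) = pair_code S A (replicate k s @ w, a)"
    by (simp add: pair_code_pad)
  have new': "pair_code S A (replicate k s @ w, a) \<notin> pair_code S A ` c"
    using new by (simp add: m p set_decode_pattern_code[OF fin])
  have n_eq: "n = pattern_code S A (insert (replicate k s @ w, a) c)"
    using pattern_code_insert[OF fin new'] by (simp add: n m p)
  have "insert (replicate k s @ w, a) c \<in> padded_codings T s S A C"
    using c wa new' Tn unfolding padded_codings_def n_eq m by blast
  then show "n \<in> pattern_code S A ` padded_codings T s S A C"
    unfolding n_eq by (rule imageI)
qed

text \<open>Both requirements on the padding length \<open>k\<close>, that the new pair is not in \<open>c\<close> and that the new code is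
  sufficient fuel, hold for all large \<open>k\<close>, because the code of the new pair is at least \<open>k\<close>.\<close>

lemma exists_padding:
  assumes c: "c \<in> C" "finite c" "(w, a) \<in> c"
    and T: "\<forall>\<^sub>F n in sequentially. T n (pattern_code S A c)"
  shows "\<exists>k. insert (replicate k s @ w, a) c \<in> padded_codings T s S A C"
proof -
  let ?p = "\<lambda>k. pair_code S A (replicate k s @ w, a)"
  let ?n = "\<lambda>k. pattern_code S A c + 2 ^ ?p k"
  have le: "k \<le> ?p k" for k
    using add_le_pad_code[of "list_encode (map (to_nat_on S) w)" k "to_nat_on S s"]
      le_prod_encode_1 unfolding pair_code_pad by (meson add_leE le_trans)
  moreover have "?p k < 2 ^ ?p k" for k by simp
  ultimately have "k \<le> ?n k" for k by (meson le_trans less_imp_le trans_le_add2)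
  then have "filterlim ?n sequentially sequentially"
    by (intro filterlim_at_top_mono[OF filterlim_ident]) simp
  then have "\<forall>\<^sub>F k in sequentially. T (?n k) (pattern_code S A c)"
    using T by (rule eventually_compose_filterlim[rotated])
  moreover have "\<forall>\<^sub>F k in sequentially. ?p k \<notin> pair_code S A ` c"
  proof -
    have "\<forall>\<^sub>F k in sequentially. Max (pair_code S A ` c) < k" by (rule eventually_gt_at_top)
    then show ?thesis
    proof eventually_elim
      case (elim k)
      with le[of k] c(2) show ?case by (meson Max_ge finite_imageI leD less_le_trans)
    qed
  qed
  ultimately have "\<forall>\<^sub>F k in sequentially.
      T (?n k) (pattern_code S A c) \<and> ?p k \<notin> pair_code S A ` c"
    by (rule eventually_conj)
  then obtain k where k: "T (?n k) (pattern_code S A c)" "?p k \<notin> pair_code S A ` c"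
    using eventually_happens by fastforce
  then show ?thesis
    using c pattern_code_insert[OF c(2) k(2)] unfolding padded_codings_def by fastforce
qed


section \<open>Padding does not change the subshift\<close>

definition occurs_at ::
    "('g, 'm) monoid_scheme \<Rightarrow> ('g list \<times> 'a) set \<Rightarrow> ('g \<Rightarrow> 'a) \<Rightarrow> 'g \<Rightarrow> bool" where
  "occurs_at G c x g \<longleftrightarrow> (\<forall>(w, a)\<in>c. x (g \<otimes>\<^bsub>G\<^esub> word_value G w) = a)"

lemma mem_avoiding_iff:
  "x \<in> avoiding G A C \<longleftrightarrow>
    x \<in> full_shift G A \<and> (\<forall>g\<in>carrier G. \<forall>c\<in>C. \<not> occurs_at G c x g)"
proof (cases "x \<in> full_shift G A")
  case True
  then have "(x \<in> cylinder G A a h) = (x h = a)" for a h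
    by (simp add: cylinder_def)
  then show ?thesis
    using True unfolding avoiding_def occurs_at_def by (simp add: case_prod_unfold)
qed (simp add: avoiding_def)

lemma avoiding_cong:
  assumes "\<And>c. c \<in> C \<Longrightarrow> \<exists>d\<in>D. occurs_at G c = occurs_at G d"
    and "\<And>d. d \<in> D \<Longrightarrow> \<exists>c\<in>C. occurs_at G c = occurs_at G d"
  shows "avoiding G A C = avoiding G A D"
proof (rule Set.set_eqI)
  fix x
  show "x \<in> avoiding G A C \<longleftrightarrow> x \<in> avoiding G A D"
    using assms unfolding mem_avoiding_iff by metis
qed

lemma (in monoid) word_value_closed:
  "w \<in> lists (carrier G) \<Longrightarrow> word_value G w \<in> carrier G"
  by (induction w) (auto simp: word_value_def)

lemma (in monoid) word_value_replicate_one: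
  "w \<in> lists (carrier G) \<Longrightarrow> word_value G (replicate k \<one> @ w) = word_value G w"
  using word_value_closed[of w] by (induction k) (simp_all add: word_value_def)

lemma (in monoid) occurs_at_insert_padded:
  assumes "(w, a) \<in> c" "w \<in> lists (carrier G)"
  shows "occurs_at G (insert (replicate k \<one> @ w, a) c) = occurs_at G c"
  using assms by (intro ext) (auto simp: occurs_at_def word_value_replicate_one)

text \<open>The only coding that cannot be padded, \<open>{}\<close>, occurs everywhere.\<close>

lemma (in monoid) avoiding_eq_empty:
  assumes "{} \<in> C"
  shows "avoiding G A C = {}"
proof -
  have "occurs_at G {} x \<one>" for x :: "'a \<Rightarrow> 'c" by (simp add: occurs_at_def)
  then show ?thesis using assms one_closed by (blast dest: mem_avoiding_iff[THEN iffD1])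
qed

lemma decidable_codings_empty: "decidable_codings S A {{}}"
proof -
  have "decidable_rel 1 (\<lambda>xs. hd xs \<in> {0})"
    unfolding singleton_iff by (rule computable_intros | simp)+
  then show ?thesis
    by (simp add: decidable_codings_def pattern_codings_def pattern_code_def
        decidable_set_if_decidable_rel)
qed

theorem proposition2p1:
  fixes G :: "('g, 'm) monoid_scheme" and S :: "'g set" and A :: "'a set"
    and X :: "('g \<Rightarrow> 'a) set"
  assumes "group G"
    and "symmetric_generating_set G S"
    and "finite A"
    and "subshift G A X"
    and "effectively_closed G S A X"
  shows "\<exists>C. decidable_codings S A C \<and> X = avoiding G A C"
proof -
  interpret group G by (rule assms(1))
  have S: "S \<subseteq> carrier G" "\<one>\<^bsub>G\<^esub> \<in> S"
    using assms(2) by (simp_all add: symmetric_generating_set_def)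
  obtain C where C: "C \<subseteq> pattern_codings S A" and X: "X = avoiding G A C"
    and re: "recursively_enumerable_set (pattern_code S A ` C)"
    using assms(5) unfolding effectively_closed_def recursively_enumerable_codings_def by blast
  show ?thesis
  proof (cases "{} \<in> C")
    case True
    then have "X = avoiding G A {{}}" by (simp add: X avoiding_eq_empty)
    then show ?thesis using decidable_codings_empty by blast
  next
    case False
    obtain r where r: "\<And>n. n \<in> pattern_code S A ` C \<longleftrightarrow> (\<exists>y. computes r [n] y)"
      using re unfolding recursively_enumerable_set_def by blast
    let ?T = "\<lambda>n m. fuel_eval r n [m] \<noteq> 0"
    define D where "D = padded_codings ?T \<one>\<^bsub>G\<^esub> S A C"
    have sound: "m \<in> pattern_code S A ` C" if "?T n m" for n m
      using that r computes_if_fuel_eval by (metis not0_implies_Suc)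
    have complete: "\<forall>\<^sub>F n in sequentially. ?T n (pattern_code S A c)" if c: "c \<in> C" for c
    proof -
      obtain y where "computes r [pattern_code S A c] y" using r c by blast
      from eventually_fuel_eval[OF this] show ?thesis by eventually_elim simp
    qed
    have "pattern_code S A ` D = padded_codes ?T (to_nat_on S \<one>\<^bsub>G\<^esub>)"
      unfolding D_def using C sound by (rule pattern_code_padded_codings)
    then have "decidable_codings S A D"
      unfolding decidable_codings_def
      using padded_codings_subset[OF C S(2)] decidable_padded_codes by (simp add: D_def)
    moreover have "avoiding G A C = avoiding G A D"
    proof (rule avoiding_cong)
      have words: "w \<in> lists (carrier G)" if "c \<in> C" "(w, a) \<in> c" for c w a
        using that C S(1) by (fastforce simp: pattern_codings_def in_lists_conv_set)
      show "\<exists>d\<in>D. occurs_at G c = occurs_at G d" if c: "c \<in> C" for c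
      proof -
        obtain w a where wa: "(w, a) \<in> c" using False c by (metis ex_in_conv surj_pair)
        have "finite c" using C c by (auto simp: pattern_codings_def)
        then obtain k where "insert (replicate k \<one>\<^bsub>G\<^esub> @ w, a) c \<in> D"
          using exists_padding[where T = ?T, OF c _ wa complete[OF c]] unfolding D_def by blast
        then show ?thesis using occurs_at_insert_padded[OF wa words[OF c wa]] by metis
      qed
      show "\<exists>c\<in>C. occurs_at G c = occurs_at G d" if d: "d \<in> D" for d
      proof -
        obtain k w a c where "d = insert (replicate k \<one>\<^bsub>G\<^esub> @ w, a) c"
          and c: "c \<in> C" and wa: "(w, a) \<in> c"
          using d unfolding D_def padded_codings_def by blast
        then show ?thesis using occurs_at_insert_padded[OF wa words[OF c wa]] by metis
      qed
    qed
    ultimately show ?thesis using X by blast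
  qed
qed

end
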